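(* Let $X$ be a finite set with $|X|=n$, and let $a\in\mathcal T_X$ be an idempotent with $r=\operatorname{rank}(a)$, where $1<r<n$. Put $A=\operatorname{im}(a)$ and $\alpha=\ker(a)$. There is a well-defined monomorphism $$\psi:\operatorname{Reg}(\mathcal T_X^a)\to\operatorname{Reg}(\mathcal T(X,A))\times\operatorname{Reg}(\mathcal T(X,\alpha)):f\mapsto(fa,af).$$ The image of $\psi$ is the set $$\operatorname{im}(\psi)=\{(g,h)\in\operatorname{Reg}(\mathcal T(X,A))\times\operatorname{Reg}(\mathcal T(X,\alpha)):\operatorname{rank}(g)=\operatorname{rank}(h),\ g|_A=(ha)|_A\}.$$ In particular, $\operatorname{Reg}(\mathcal T_X^a)$ is (isomorphic to) a subdirect product of $\operatorname{Reg}(\mathcal T(X,A))$ and $\operatorname{Reg}(\mathcal T(X,\alpha))$.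
   Context: $\mathcal T_X$ is the full transformation semigroup of all maps $X\to X$ under composition; maps are written on the right and composed from left to right. $\operatorname{im}(f)=\{xf:x\in X\}$, $\ker(f)=\{(x,y):xf=yf\}$, $\operatorname{rank}(f)=|\operatorname{im}(f)|$. The variant $\mathcal T_X^a$ is the semigroup with underlying set $\mathcal T_X$ and operation $f\star g=fag$. $\mathcal T(X,A)=\{f\in\mathcal T_X:\operatorname{im}(f)\subseteq A\}$ and $\mathcal T(X,\alpha)=\{f\in\mathcal T_X:\ker(f)\supseteq\alpha\}$ are subsemigroups of $\mathcal T_X$ under composition. $\operatorname{Reg}(S)$ is the set of regular elements of a semigroup $S$ ($x$ is regular if $x=xyx$ and $y=yxy$ for some $y\in S$). $\operatorname{Reg}(\mathcal T_X^a)$ is a subsemigroup of $\mathcal T_X^a$, with operation $\star$; $\operatorname{Reg}(\mathcal T(X,A))$ and $\operatorname{Reg}(\mathcal T(X,\alpha))$ are semigroups under composition. A subdirect product of $S$ and $T$ is a subsemigroup of $S\times T$ that projects onto both $S$ and $T$. *)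

theory Defs
  imports "HOL-Library.FuncSet" "HOL-Library.Cardinality"
begin

text \<open>HOL-Algebra has no structure without an identity element, and the variant semigroups below
  have none in general; hence a small record of our own.\<close>

record 'a sgrp =
  elts :: "'a set"
  mul :: "'a \<Rightarrow> 'a \<Rightarrow> 'a"

definition is_sgrp :: "'a sgrp \<Rightarrow> bool" where
  "is_sgrp S \<longleftrightarrow>
     (\<forall>x\<in>elts S. \<forall>y\<in>elts S. mul S x y \<in> elts S) \<and>
     (\<forall>x\<in>elts S. \<forall>y\<in>elts S. \<forall>z\<in>elts S. mul S (mul S x y) z = mul S x (mul S y z))"

definition is_subsgrp :: "'a set \<Rightarrow> 'a sgrp \<Rightarrow> bool" where
  "is_subsgrp U S \<longleftrightarrow> is_sgrp S \<and> U \<subseteq> elts S \<and> (\<forall>x\<in>U. \<forall>y\<in>U. mul S x y \<in> U)"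

definition sub_sgrp :: "'a sgrp \<Rightarrow> 'a set \<Rightarrow> 'a sgrp" where
  "sub_sgrp S U = \<lparr>elts = U, mul = mul S\<rparr>"

definition prod_sgrp :: "'a sgrp \<Rightarrow> 'b sgrp \<Rightarrow> ('a \<times> 'b) sgrp" where
  "prod_sgrp S T = \<lparr>elts = elts S \<times> elts T,
     mul = (\<lambda>p q. (mul S (fst p) (fst q), mul T (snd p) (snd q)))\<rparr>"

text \<open>Source and target are required to be semigroups, so that in particular closure under
  multiplication is part of the assertion that a map is a homomorphism.\<close>

definition sgrp_hom :: "'a sgrp \<Rightarrow> 'b sgrp \<Rightarrow> ('a \<Rightarrow> 'b) \<Rightarrow> bool" where
  "sgrp_hom S T \<phi> \<longleftrightarrow> is_sgrp S \<and> is_sgrp T \<and> \<phi> \<in> elts S \<rightarrow> elts T \<and>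
     (\<forall>x\<in>elts S. \<forall>y\<in>elts S. \<phi> (mul S x y) = mul T (\<phi> x) (\<phi> y))"

definition sgrp_mono :: "'a sgrp \<Rightarrow> 'b sgrp \<Rightarrow> ('a \<Rightarrow> 'b) \<Rightarrow> bool" where
  "sgrp_mono S T \<phi> \<longleftrightarrow> sgrp_hom S T \<phi> \<and> inj_on \<phi> (elts S)"

definition sgrp_isomorphic :: "'a sgrp \<Rightarrow> 'b sgrp \<Rightarrow> bool" where
  "sgrp_isomorphic S T \<longleftrightarrow> (\<exists>\<phi>. sgrp_hom S T \<phi> \<and> bij_betw \<phi> (elts S) (elts T))"

definition subdirect_product :: "('a \<times> 'b) set \<Rightarrow> 'a sgrp \<Rightarrow> 'b sgrp \<Rightarrow> bool" where
  "subdirect_product P S T \<longleftrightarrow>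
     is_subsgrp P (prod_sgrp S T) \<and> fst ` P = elts S \<and> snd ` P = elts T"

definition regular_elt :: "'a sgrp \<Rightarrow> 'a \<Rightarrow> bool" where
  "regular_elt S x \<longleftrightarrow> x \<in> elts S \<and>
     (\<exists>y\<in>elts S. x = mul S (mul S x y) x \<and> y = mul S (mul S y x) y)"

definition Reg :: "'a sgrp \<Rightarrow> 'a sgrp" where
  "Reg S = sub_sgrp S {x. regular_elt S x}"

text \<open>The set \<open>X\<close> is the universe of the type \<open>'x\<close>.  Maps are composed from left to right:
  \<open>f \<Zsemi> g\<close> is the product written \<open>fg\<close> when maps act on the right.\<close>

definition rcomp :: "('x \<Rightarrow> 'x) \<Rightarrow> ('x \<Rightarrow> 'x) \<Rightarrow> ('x \<Rightarrow> 'x)" (infixl "\<Zsemi>" 70) where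
  "f \<Zsemi> g = (\<lambda>x. g (f x))"

definition ker :: "('x \<Rightarrow> 'x) \<Rightarrow> ('x \<times> 'x) set" where
  "ker f = {(x, y). f x = f y}"

definition rank :: "('x \<Rightarrow> 'x) \<Rightarrow> nat" where
  "rank f = card (range f)"

definition T_variant :: "('x \<Rightarrow> 'x) \<Rightarrow> ('x \<Rightarrow> 'x) sgrp" where
  "T_variant a = \<lparr>elts = UNIV, mul = (\<lambda>f g. f \<Zsemi> a \<Zsemi> g)\<rparr>"

definition T_im :: "'x set \<Rightarrow> ('x \<Rightarrow> 'x) sgrp" where
  "T_im A = \<lparr>elts = {f. range f \<subseteq> A}, mul = (\<Zsemi>)\<rparr>"

definition T_ker :: "('x \<times> 'x) set \<Rightarrow> ('x \<Rightarrow> 'x) sgrp" where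
  "T_ker \<alpha> = \<lparr>elts = {f. ker f \<supseteq> \<alpha>}, mul = (\<Zsemi>)\<rparr>"

definition psi :: "('x \<Rightarrow> 'x) \<Rightarrow> ('x \<Rightarrow> 'x) \<Rightarrow> ('x \<Rightarrow> 'x) \<times> ('x \<Rightarrow> 'x)" where
  "psi a f = (f \<Zsemi> a, a \<Zsemi> f)"

end

theory Submission
  imports Defs
begin

text \<open>
  Write products from left to right.  Everything follows from pointwise descriptions of the regular
  elements of the three semigroups, with \<open>A\<close> the image of the idempotent \<open>a\<close> and \<open>\<alpha>\<close> its kernel:

    \<^item> \<open>g\<close> is regular in \<open>T(X, A)\<close> iff its image lies in \<open>A\<close> and is already attained on \<open>A\<close>;
    \<^item> \<open>h\<close> is regular in \<open>T(X, \<alpha>)\<close> iff \<open>h = ah\<close> and \<open>a\<close> is injective on the image of \<open>h\<close>;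
    \<^item> \<open>f\<close> is regular in the variant iff its image is attained on \<open>A\<close> and \<open>a\<close> is injective on it.

  Hence if \<open>f\<close> is regular in the variant, then \<open>fa\<close> and \<open>af\<close> are regular in the other two.  The value
  of \<open>f\<close> at \<open>x\<close> can be recovered from this pair, as the unique point \<open>w\<close> in the image of \<open>af\<close> with
  \<open>wa = x(fa)\<close>; so \<open>\<psi>\<close> is injective.  For an arbitrary pair \<open>(g, h)\<close> of regular elements such that \<open>g\<close>
  and \<open>ha\<close> agree on \<open>A\<close>, the same recipe defines a preimage, since \<open>a\<close> then maps the image of \<open>h\<close>
  bijectively onto the image of \<open>g\<close>.  In particular such \<open>g\<close> and \<open>h\<close> have equal rank.

  The projections of the image are onto because the pairs \<open>(g, ag)\<close> and \<open>(ha, h)\<close> satisfy this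
  condition.
\<close>

section \<open>Semigroups, regular elements and images of homomorphisms\<close>

lemma elts_Reg: "elts (Reg S) = {x. regular_elt S x}"
  and mul_Reg: "mul (Reg S) = mul S"
  by (simp_all add: Reg_def sub_sgrp_def)

text \<open>An inner inverse suffices for regularity: if \<open>x = xyx\<close>, then \<open>yxy\<close> and \<open>x\<close> are mutually
  inverse.\<close>

lemma regular_elt_iff_inner_inverse:
  assumes S: "is_sgrp S"
  shows "regular_elt S x \<longleftrightarrow> x \<in> elts S \<and> (\<exists>y\<in>elts S. mul S (mul S x y) x = x)"
proof
  assume "regular_elt S x"
  then show "x \<in> elts S \<and> (\<exists>y\<in>elts S. mul S (mul S x y) x = x)"
    unfolding regular_elt_def by metis
next
  assume "x \<in> elts S \<and> (\<exists>y\<in>elts S. mul S (mul S x y) x = x)"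
  then obtain y where x: "x \<in> elts S" and y: "y \<in> elts S" and xyx: "mul S (mul S x y) x = x"
    by blast
  have closed: "mul S u v \<in> elts S" if "u \<in> elts S" "v \<in> elts S" for u v
    using S that unfolding is_sgrp_def by blast
  have assoc: "mul S (mul S u v) w = mul S u (mul S v w)"
    if "u \<in> elts S" "v \<in> elts S" "w \<in> elts S" for u v w
    using S that unfolding is_sgrp_def by blast
  have xyx': "mul S x (mul S y x) = x"
    using xyx x y by (simp add: assoc)
  have xyxz: "mul S x (mul S y (mul S x z)) = mul S x z" if "z \<in> elts S" for z
    using xyx' x y that by (metis assoc closed)
  let ?y = "mul S (mul S y x) y"
  have "?y \<in> elts S"
    using x y by (simp add: closed)
  moreover have "x = mul S (mul S x ?y) x" "?y = mul S (mul S ?y x) ?y"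
    using x y by (simp_all add: assoc closed xyx' xyxz)
  ultimately show "regular_elt S x"
    unfolding regular_elt_def using x by blast
qed

lemma is_sgrp_prod_sgrp:
  assumes "is_sgrp S" and "is_sgrp T"
  shows "is_sgrp (prod_sgrp S T)"
  using assms unfolding is_sgrp_def prod_sgrp_def by auto

lemma is_sgrp_sub_sgrp:
  assumes "is_sgrp S" and "U \<subseteq> elts S" and "\<And>x y. x \<in> U \<Longrightarrow> y \<in> U \<Longrightarrow> mul S x y \<in> U"
  shows "is_sgrp (sub_sgrp S U)"
  using assms unfolding is_sgrp_def sub_sgrp_def by (simp add: subset_iff)

lemma is_subsgrp_hom_image:
  assumes "sgrp_hom S T \<phi>"
  shows "is_subsgrp (\<phi> ` elts S) T"
  unfolding is_subsgrp_def
proof (intro conjI ballI)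
  show "is_sgrp T" and "\<phi> ` elts S \<subseteq> elts T"
    using assms unfolding sgrp_hom_def by auto
  fix u v
  assume "u \<in> \<phi> ` elts S" and "v \<in> \<phi> ` elts S"
  then obtain x y where xy: "x \<in> elts S" "y \<in> elts S" and "u = \<phi> x" "v = \<phi> y"
    by blast
  then have "mul T u v = \<phi> (mul S x y)" and "mul S x y \<in> elts S"
    using assms unfolding sgrp_hom_def is_sgrp_def by auto
  then show "mul T u v \<in> \<phi> ` elts S"
    by blast
qed

lemma sgrp_mono_isomorphic_image:
  assumes "sgrp_mono S T \<phi>"
  shows "sgrp_isomorphic S (sub_sgrp T (\<phi> ` elts S))"
proof -
  have hom: "sgrp_hom S T \<phi>" and inj: "inj_on \<phi> (elts S)"
    using assms unfolding sgrp_mono_def by auto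
  have "is_sgrp (sub_sgrp T (\<phi> ` elts S))"
    using is_subsgrp_hom_image[OF hom] unfolding is_subsgrp_def
    by (intro is_sgrp_sub_sgrp) auto
  then have "sgrp_hom S (sub_sgrp T (\<phi> ` elts S)) \<phi>"
    using hom unfolding sgrp_hom_def by (simp add: sub_sgrp_def)
  moreover have "bij_betw \<phi> (elts S) (elts (sub_sgrp T (\<phi> ` elts S)))"
    using inj by (simp add: bij_betw_def sub_sgrp_def)
  ultimately show ?thesis
    unfolding sgrp_isomorphic_def by blast
qed

section \<open>Regular elements of the three transformation semigroups\<close>

lemma is_sgrp_T_variant: "is_sgrp (T_variant a)"
  by (simp add: is_sgrp_def T_variant_def rcomp_def)

lemma is_sgrp_T_im: "is_sgrp (T_im A)"
  by (auto simp: is_sgrp_def T_im_def rcomp_def)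

lemma is_sgrp_T_ker: "is_sgrp (T_ker \<alpha>)"
  by (auto simp: is_sgrp_def T_ker_def rcomp_def ker_def)

context
  fixes a :: "'x \<Rightarrow> 'x"
  assumes idem: "\<And>x. a (a x) = a x"
begin

lemma range_eq_image_rangeE:
  assumes "range f = f ` range b"
  obtains u where "f x = f (b u)"
proof -
  have "f x \<in> f ` range b"
    unfolding assms[symmetric] by (rule rangeI)
  then show thesis
    using that by blast
qed

lemma regular_T_variant_iff:
  "regular_elt (T_variant a) f \<longleftrightarrow> range f = f ` range a \<and> inj_on a (range f)"
proof
  assume "regular_elt (T_variant a) f"
  then obtain y where "f = (\<lambda>x. f (a (y (a (f x)))))"
    by (auto simp: regular_elt_def T_variant_def rcomp_def)
  then have y: "f x = f (a (y (a (f x))))" for x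
    by metis
  have "range f \<subseteq> f ` range a"
    using y by blast
  moreover have "inj_on a (range f)"
    by (rule inj_onI) (metis y rangeE)
  ultimately show "range f = f ` range a \<and> inj_on a (range f)"
    by blast
next
  assume "range f = f ` range a \<and> inj_on a (range f)"
  then have range_f: "range f = f ` range a" and inj: "inj_on a (range f)"
    by auto
  \<comment> \<open>as \<open>a\<close> is injective on the image of \<open>f\<close>, it suffices that \<open>yafa\<close> fixes the image of \<open>fa\<close>\<close>
  define y where "y z = (SOME u. a (f (a u)) = z)" for z
  have "f (a (y (a (f x)))) = f x" for x
  proof -
    obtain u where u: "f x = f (a u)"
      using range_f by (rule range_eq_image_rangeE)
    have "a (f (a (y (a (f x))))) = a (f x)"
      using someI[of "\<lambda>v. a (f (a v)) = a (f x)" u] u by (simp add: y_def)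
    then show ?thesis
      by (rule inj_onD[OF inj _ rangeI rangeI])
  qed
  then show "regular_elt (T_variant a) f"
    unfolding regular_elt_iff_inner_inverse[OF is_sgrp_T_variant]
    by (auto simp: T_variant_def rcomp_def)
qed

lemma range_subset_range_idem_iff: "range g \<subseteq> range a \<longleftrightarrow> (\<forall>x. a (g x) = g x)"
proof (intro iffI allI)
  fix x
  assume "range g \<subseteq> range a"
  then obtain u where "g x = a u"
    by blast
  then show "a (g x) = g x"
    by (simp add: idem)
next
  assume "\<forall>x. a (g x) = g x"
  then have "g x \<in> range a" for x
    by (metis rangeI)
  then show "range g \<subseteq> range a"
    by (rule image_subsetI)
qed

lemma regular_T_im_iff:
  "regular_elt (T_im (range a)) g \<longleftrightarrow> (\<forall>x. a (g x) = g x) \<and> range g = g ` range a"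
proof
  assume reg: "regular_elt (T_im (range a)) g"
  then obtain y where y: "range y \<subseteq> range a" and "g = (\<lambda>x. g (y (g x)))"
    by (auto simp: regular_elt_def T_im_def rcomp_def)
  then have "g x = g (y (g x))" for x
    by metis
  then have "range g \<subseteq> g ` range a"
    using y by blast
  moreover have "\<forall>x. a (g x) = g x"
    using reg unfolding range_subset_range_idem_iff[symmetric]
    by (simp add: regular_elt_def T_im_def)
  ultimately show "(\<forall>x. a (g x) = g x) \<and> range g = g ` range a"
    by blast
next
  assume g: "(\<forall>x. a (g x) = g x) \<and> range g = g ` range a"
  define y where "y z = a (SOME u. g (a u) = z)" for z
  have "g (y (g x)) = g x" for x
  proof -
    obtain u where "g x = g (a u)"
      using g by (blast elim: range_eq_image_rangeE)
    then show ?thesis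
      using someI[of "\<lambda>v. g (a v) = g x" u] by (simp add: y_def)
  qed
  moreover have "range y \<subseteq> range a"
    by (auto simp: y_def)
  moreover have "range g \<subseteq> range a"
    unfolding range_subset_range_idem_iff using g by (rule conjunct1)
  ultimately show "regular_elt (T_im (range a)) g"
    unfolding regular_elt_iff_inner_inverse[OF is_sgrp_T_im]
    by (intro conjI bexI[of _ y]) (simp_all add: T_im_def rcomp_def)
qed

lemma ker_idem_subset_ker_iff: "ker a \<subseteq> ker h \<longleftrightarrow> (\<forall>x. h (a x) = h x)"
proof
  assume "ker a \<subseteq> ker h"
  then show "\<forall>x. h (a x) = h x"
    using idem by (auto simp: ker_def)
next
  assume "\<forall>x. h (a x) = h x"
  then show "ker a \<subseteq> ker h"
    by (auto simp: ker_def) metis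
qed

lemma regular_T_ker_iff:
  "regular_elt (T_ker (ker a)) h \<longleftrightarrow> (\<forall>x. h (a x) = h x) \<and> inj_on a (range h)"
proof
  assume reg: "regular_elt (T_ker (ker a)) h"
  then obtain y where "ker a \<subseteq> ker y" and "h = (\<lambda>x. h (y (h x)))"
    by (auto simp: regular_elt_def T_ker_def rcomp_def)
  then have y: "y (a x) = y x" and h: "h x = h (y (h x))" for x
    using ker_idem_subset_ker_iff[of y] by metis+
  have "inj_on a (range h)"
    by (rule inj_onI) (metis y h rangeE)
  moreover have "ker a \<subseteq> ker h"
    using reg by (simp add: regular_elt_def T_ker_def)
  ultimately show "(\<forall>x. h (a x) = h x) \<and> inj_on a (range h)"
    using ker_idem_subset_ker_iff by blast
next
  assume h: "(\<forall>x. h (a x) = h x) \<and> inj_on a (range h)"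
  \<comment> \<open>matching \<open>a (h u)\<close> with \<open>a z\<close>, not \<open>h u\<close> with \<open>z\<close>, makes \<open>y\<close> constant on \<open>ker a\<close>-classes\<close>
  define y where "y z = (SOME u. a (h u) = a z)" for z
  have "h (y (h x)) = h x" for x
  proof -
    have "a (h (y (h x))) = a (h x)"
      using someI[of "\<lambda>v. a (h v) = a (h x)" x] by (simp add: y_def)
    then show ?thesis
      using h by (simp add: inj_on_def)
  qed
  moreover have "ker a \<subseteq> ker y" and "ker a \<subseteq> ker h"
    using h ker_idem_subset_ker_iff idem by (auto simp: y_def)
  ultimately show "regular_elt (T_ker (ker a)) h"
    unfolding regular_elt_iff_inner_inverse[OF is_sgrp_T_ker]
    by (auto simp: T_ker_def rcomp_def)
qed

lemma is_sgrp_Reg_T_variant: "is_sgrp (Reg (T_variant a))"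
  unfolding Reg_def
proof (rule is_sgrp_sub_sgrp[OF is_sgrp_T_variant])
  fix f f'
  assume "f \<in> {x. regular_elt (T_variant a) x}" and "f' \<in> {x. regular_elt (T_variant a) x}"
  then have f: "range f = f ` range a" "inj_on a (range f)"
    and f': "range f' = f' ` range a" "inj_on a (range f')"
    unfolding mem_Collect_eq regular_T_variant_iff by blast+
  let ?p = "\<lambda>x. f' (a (f x))"
  have "range ?p = (\<lambda>z. f' (a z)) ` range f"
    by (simp add: image_image)
  also have "\<dots> = ?p ` range a"
    unfolding f(1) by (simp add: image_image)
  finally have "range ?p = ?p ` range a" .
  moreover have "inj_on a (range ?p)"
    using f'(2) by (rule inj_on_subset) auto
  moreover have "mul (T_variant a) f f' = ?p"
    by (simp add: T_variant_def rcomp_def)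
  ultimately show "mul (T_variant a) f f' \<in> {x. regular_elt (T_variant a) x}"
    unfolding mem_Collect_eq regular_T_variant_iff by metis
qed (simp add: T_variant_def)

lemma is_sgrp_Reg_T_im: "is_sgrp (Reg (T_im (range a)))"
  unfolding Reg_def
proof (rule is_sgrp_sub_sgrp[OF is_sgrp_T_im])
  fix g g'
  assume "g \<in> {x. regular_elt (T_im (range a)) x}" and "g' \<in> {x. regular_elt (T_im (range a)) x}"
  then have g: "range g = g ` range a" and g': "\<forall>x. a (g' x) = g' x"
    by (simp_all add: regular_T_im_iff)
  have "range (\<lambda>x. g' (g x)) = g' ` range g"
    by (simp add: image_image)
  also have "\<dots> = (\<lambda>x. g' (g x)) ` range a"
    unfolding g by (simp add: image_image)
  finally show "mul (T_im (range a)) g g' \<in> {x. regular_elt (T_im (range a)) x}"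
    using g' by (simp add: regular_T_im_iff) (simp add: T_im_def rcomp_def)
qed (auto simp: regular_elt_def)

lemma is_sgrp_Reg_T_ker: "is_sgrp (Reg (T_ker (ker a)))"
  unfolding Reg_def
proof (rule is_sgrp_sub_sgrp[OF is_sgrp_T_ker])
  fix h h'
  assume "h \<in> {x. regular_elt (T_ker (ker a)) x}" and "h' \<in> {x. regular_elt (T_ker (ker a)) x}"
  then have h: "\<forall>x. h (a x) = h x" and h': "inj_on a (range h')"
    by (simp_all add: regular_T_ker_iff)
  have "inj_on a (range (\<lambda>x. h' (h x)))"
    using h' by (rule inj_on_subset) auto
  then show "mul (T_ker (ker a)) h h' \<in> {x. regular_elt (T_ker (ker a)) x}"
    using h by (simp add: regular_T_ker_iff) (simp add: T_ker_def rcomp_def)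
qed (auto simp: regular_elt_def)

section \<open>The map \<open>\<psi>\<close> and its image\<close>

lemma psi_regular:
  assumes f: "regular_elt (T_variant a) f"
  shows "regular_elt (T_im (range a)) (f \<Zsemi> a)" and "regular_elt (T_ker (ker a)) (a \<Zsemi> f)"
proof -
  have range_f: "range f = f ` range a" and inj: "inj_on a (range f)"
    using f unfolding regular_T_variant_iff by blast+
  have "range (\<lambda>x. a (f x)) = a ` range f"
    by (simp add: image_image)
  also have "\<dots> = (\<lambda>x. a (f x)) ` range a"
    unfolding range_f by (simp add: image_image)
  finally show "regular_elt (T_im (range a)) (f \<Zsemi> a)"
    by (simp add: regular_T_im_iff rcomp_def idem)
  have "inj_on a (range (\<lambda>x. f (a x)))"
    using inj by (rule inj_on_subset) auto
  then show "regular_elt (T_ker (ker a)) (a \<Zsemi> f)"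
    by (simp add: regular_T_ker_iff rcomp_def idem)
qed

lemma inj_on_psi: "inj_on (psi a) (elts (Reg (T_variant a)))"
proof (rule inj_onI)
  fix f f'
  assume "f \<in> elts (Reg (T_variant a))" and "f' \<in> elts (Reg (T_variant a))"
    and eq: "psi a f = psi a f'"
  then have range_f: "range f = f ` range a" and inj: "inj_on a (range f')"
    unfolding elts_Reg mem_Collect_eq regular_T_variant_iff by blast+
  have fa: "a (f x) = a (f' x)" and af: "f (a x) = f' (a x)" for x
    using eq by (auto simp: psi_def rcomp_def dest: fun_cong)
  show "f = f'"
  proof
    fix x
    obtain u where u: "f x = f (a u)"
      using range_f by (rule range_eq_image_rangeE)
    then have "a (f' (a u)) = a (f' x)"
      using fa af by metis
    then show "f x = f' x"
      using inj u af by (simp add: inj_on_def)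
  qed
qed

lemma sgrp_mono_psi:
  "sgrp_mono (Reg (T_variant a)) (prod_sgrp (Reg (T_im (range a))) (Reg (T_ker (ker a)))) (psi a)"
  unfolding sgrp_mono_def sgrp_hom_def
proof (intro conjI ballI)
  show "is_sgrp (Reg (T_variant a))"
    by (rule is_sgrp_Reg_T_variant)
  show "is_sgrp (prod_sgrp (Reg (T_im (range a))) (Reg (T_ker (ker a))))"
    by (intro is_sgrp_prod_sgrp is_sgrp_Reg_T_im is_sgrp_Reg_T_ker)
  show "psi a \<in> elts (Reg (T_variant a)) \<rightarrow>
      elts (prod_sgrp (Reg (T_im (range a))) (Reg (T_ker (ker a))))"
    using psi_regular by (auto simp: prod_sgrp_def elts_Reg psi_def)
  show "inj_on (psi a) (elts (Reg (T_variant a)))"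
    by (rule inj_on_psi)
  fix f f'
  show "psi a (mul (Reg (T_variant a)) f f') =
      mul (prod_sgrp (Reg (T_im (range a))) (Reg (T_ker (ker a)))) (psi a f) (psi a f')"
    by (simp add: prod_sgrp_def mul_Reg psi_def T_variant_def T_im_def T_ker_def rcomp_def)
qed

text \<open>The image of \<open>\<psi>\<close>, without a rank condition.\<close>

lemma psi_image_iff:
  "(g, h) \<in> psi a ` elts (Reg (T_variant a)) \<longleftrightarrow>
     regular_elt (T_im (range a)) g \<and> regular_elt (T_ker (ker a)) h \<and>
     (\<forall>x\<in>range a. g x = a (h x))"
proof
  assume "(g, h) \<in> psi a ` elts (Reg (T_variant a))"
  then obtain f where "regular_elt (T_variant a) f" "g = f \<Zsemi> a" "h = a \<Zsemi> f"
    by (auto simp: elts_Reg psi_def)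
  then show "regular_elt (T_im (range a)) g \<and> regular_elt (T_ker (ker a)) h \<and>
      (\<forall>x\<in>range a. g x = a (h x))"
    using psi_regular by (auto simp: rcomp_def idem)
next
  assume "regular_elt (T_im (range a)) g \<and> regular_elt (T_ker (ker a)) h \<and>
      (\<forall>x\<in>range a. g x = a (h x))"
  then have range_g: "range g = g ` range a" and h: "h (a x) = h x"
    and inj: "inj_on a (range h)" and agree: "g (a x) = a (h x)" for x
    by (auto simp: regular_T_im_iff regular_T_ker_iff)
  define f where "f x = h (SOME u. a (h u) = g x)" for x
  have af: "a (f x) = g x" for x
  proof -
    obtain u where "g x = g (a u)"
      using range_g by (rule range_eq_image_rangeE)
    then show ?thesis
      using someI[of "\<lambda>v. a (h v) = g x" u] by (simp add: f_def agree)
  qed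
  have f_range: "f x \<in> range h" for x
    by (simp add: f_def)
  have fa: "f (a x) = h x" for x
    using inj_onD[OF inj _ f_range rangeI, of "a x" x] by (simp add: af agree)
  have "range f = f ` range a"
    using f_range fa by (auto simp: image_iff)
  moreover have "inj_on a (range f)"
    using inj by (rule inj_on_subset) (use f_range in auto)
  ultimately have "f \<in> elts (Reg (T_variant a))"
    by (simp add: elts_Reg regular_T_variant_iff)
  moreover have "psi a f = (g, h)"
    by (simp add: psi_def rcomp_def af fa)
  ultimately show "(g, h) \<in> psi a ` elts (Reg (T_variant a))"
    by (metis imageI)
qed

text \<open>The rank condition is automatic: \<open>a\<close> maps the image of \<open>h\<close> bijectively onto that of \<open>g\<close>.\<close>

lemma rank_eq_if_agree:
  assumes g: "regular_elt (T_im (range a)) g" and h: "regular_elt (T_ker (ker a)) h"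
    and agree: "\<forall>x\<in>range a. g x = a (h x)"
  shows "rank g = rank h"
proof -
  have "range g = g ` range a"
    using g by (simp add: regular_T_im_iff)
  also have "\<dots> = (\<lambda>x. a (h (a x))) ` UNIV"
    using agree by (simp add: image_image)
  also have "\<dots> = a ` range h"
    using h by (simp add: regular_T_ker_iff image_image)
  finally show ?thesis
    using h by (simp add: regular_T_ker_iff rank_def card_image)
qed

lemma psi_image_eq:
  "psi a ` elts (Reg (T_variant a)) =
     {(g, h). g \<in> elts (Reg (T_im (range a))) \<and> h \<in> elts (Reg (T_ker (ker a))) \<and>
        rank g = rank h \<and> restrict g (range a) = restrict (h \<Zsemi> a) (range a)}"
proof -
  have "restrict g B = restrict (h \<Zsemi> a) B \<longleftrightarrow> (\<forall>x\<in>B. g x = a (h x))" for g h B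
    by (auto simp: fun_eq_iff rcomp_def)
  then have "p \<in> psi a ` elts (Reg (T_variant a)) \<longleftrightarrow>
      (case p of (g, h) \<Rightarrow> g \<in> elts (Reg (T_im (range a))) \<and> h \<in> elts (Reg (T_ker (ker a))) \<and>
        rank g = rank h \<and> restrict g (range a) = restrict (h \<Zsemi> a) (range a))" for p
    using psi_image_iff rank_eq_if_agree unfolding elts_Reg mem_Collect_eq
    by (cases p) (simp only: case_prod_conv, blast)
  then show ?thesis
    by blast
qed

lemma subdirect_product_psi_image:
  "subdirect_product (psi a ` elts (Reg (T_variant a)))
     (Reg (T_im (range a))) (Reg (T_ker (ker a)))"
  unfolding subdirect_product_def
proof (intro conjI set_eqI iffI)
  show "is_subsgrp (psi a ` elts (Reg (T_variant a)))
      (prod_sgrp (Reg (T_im (range a))) (Reg (T_ker (ker a))))"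
    by (rule is_subsgrp_hom_image) (rule sgrp_mono_psi[unfolded sgrp_mono_def, THEN conjunct1])
next
  fix g
  assume "g \<in> fst ` psi a ` elts (Reg (T_variant a))"
  then show "g \<in> elts (Reg (T_im (range a)))"
    by (auto simp: elts_Reg psi_def intro: psi_regular)
next
  fix h
  assume "h \<in> snd ` psi a ` elts (Reg (T_variant a))"
  then show "h \<in> elts (Reg (T_ker (ker a)))"
    by (auto simp: elts_Reg psi_def intro: psi_regular)
next
  fix g
  assume "g \<in> elts (Reg (T_im (range a)))"
  then have g: "regular_elt (T_im (range a)) g" and ag: "a (g x) = g x" for x
    by (simp_all add: elts_Reg regular_T_im_iff)
  have "inj_on a (range (\<lambda>x. g (a x)))"
    by (rule inj_onI) (auto simp: ag)
  then have "regular_elt (T_ker (ker a)) (a \<Zsemi> g)"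
    by (simp add: regular_T_ker_iff rcomp_def idem)
  then have "(g, a \<Zsemi> g) \<in> psi a ` elts (Reg (T_variant a))"
    using g ag by (auto simp: psi_image_iff rcomp_def idem)
  then show "g \<in> fst ` psi a ` elts (Reg (T_variant a))"
    by (metis fst_conv imageI)
next
  fix h
  assume "h \<in> elts (Reg (T_ker (ker a)))"
  then have h: "regular_elt (T_ker (ker a)) h" and ha: "h (a x) = h x" for x
    by (simp_all add: elts_Reg regular_T_ker_iff)
  have "regular_elt (T_im (range a)) (h \<Zsemi> a)"
    by (simp add: regular_T_im_iff rcomp_def idem image_image ha)
  then have "(h \<Zsemi> a, h) \<in> psi a ` elts (Reg (T_variant a))"
    using h by (auto simp: psi_image_iff rcomp_def)
  then show "h \<in> snd ` psi a ` elts (Reg (T_variant a))"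
    by (metis snd_conv imageI)
qed

end

theorem proposition5p4:
  fixes a :: "'x::finite \<Rightarrow> 'x"
    and n r :: nat
    and A :: "'x set"
    and \<alpha> :: "('x \<times> 'x) set"
  assumes "n = CARD('x)"
    and "a \<Zsemi> a = a"
    and "r = rank a"
    and "1 < r" and "r < n"
    and "A = range a"
    and "\<alpha> = ker a"
  shows "sgrp_mono (Reg (T_variant a)) (prod_sgrp (Reg (T_im A)) (Reg (T_ker \<alpha>))) (psi a) \<and>
         psi a ` elts (Reg (T_variant a)) =
           {(g, h). g \<in> elts (Reg (T_im A)) \<and> h \<in> elts (Reg (T_ker \<alpha>)) \<and>
              rank g = rank h \<and> restrict g A = restrict (h \<Zsemi> a) A} \<and>
         subdirect_product (psi a ` elts (Reg (T_variant a))) (Reg (T_im A)) (Reg (T_ker \<alpha>)) \<and>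
         sgrp_isomorphic (Reg (T_variant a))
           (sub_sgrp (prod_sgrp (Reg (T_im A)) (Reg (T_ker \<alpha>)))
              (psi a ` elts (Reg (T_variant a))))"
proof -
  have idem: "a (a x) = a x" for x
    using fun_cong[OF assms(2), of x] by (simp add: rcomp_def)
  show ?thesis
    unfolding \<open>A = range a\<close> \<open>\<alpha> = ker a\<close>
    by (intro conjI sgrp_mono_psi psi_image_eq subdirect_product_psi_image
        sgrp_mono_isomorphic_image idem)
qed

end
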